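(* The function $\mathcal{B}:\mathbb{N}_1\times\mathbb{F}\to\mathbb{N}$ (defined recursively in the context) has the bounding property; that is, for every $m\in\mathbb{N}_1$: (1) $t\leq\mathcal{B}(m,f)$ for any $f\in\mathbb{F}$ and any $f$-bounded antichain $\alpha_1,\dots,\alpha_t\in\mathbb{N}^m$ of length $t$; (2) $\mathcal{B}(m,f)\leq\mathcal{B}(m,f')$ for any $f,f'\in\mathbb{F}$ such that $f(n)\leq f'(n)$ for all $n\in\mathbb{N}_1$.
   Context: $\mathbb{N}=\{0,1,2,\dots\}$, $\mathbb{N}_1=\mathbb{N}\setminus\{0\}$, and $\mathbb{F}$ is the set of all non-decreasing functions $\mathbb{N}_1\to\mathbb{N}_1$. For $\alpha,\beta\in\mathbb{N}^m$ write $\alpha\parallel\beta$ if $\alpha+\gamma=\beta$ for some $\gamma\in\mathbb{N}^m$ (i.e. $\alpha\leq\beta$ coordinatewise). For $\alpha=(a_1,\dots,a_m)$ put $|\alpha|=a_1+\dots+a_m$. A sequence $\alpha_1,\dots,\alpha_t\in\mathbb{N}^m$ is an antichain if $\alpha_i\nparallel\alpha_j$ for all $i<j$ (only this direction is required). For $f\in\mathbb{F}$ an antichain $\alpha_1,\dots,\alpha_t$ is $f$-bounded if $|\alpha_i|\leq f(i)$ for $i=1,\dots,t$. Definition of $\mathcal{B}$. For $f\in\mathbb{F}$ and $s\in\mathbb{N}$ let ${}^{s}f\in\mathbb{F}$ be given by ${}^{s}f(n)=f(s+n)$. The function $\mathcal{B}$ is defined by recursion on $m$. Put $\mathcal{B}(1,f)=f(1)+1$.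 For $m\geq 2$, assuming that $\mathcal{B}(m-1,\cdot)$ is defined, define functions $\mathcal{B}_m^k:\mathbb{F}\times\mathbb{N}^k\to\mathbb{N}$ for $k=m,m-1,\dots,0$ by backward recursion on $k$: (i) $\mathcal{B}_m^m(f,b_1,\dots,b_m)=(b_1+1)\cdots(b_m+1)$; (ii) for $0\leq k\leq m-1$, $f\in\mathbb{F}$ and $\beta\in\mathbb{N}^k$, let $g:\mathbb{N}_1\to\mathbb{N}_1$ be given by $g(1)=1$ and $g(n+1)=1+g(n)+\mathcal{B}_m^{k+1}\big({}^{g(n)}f,\beta,f(g(n))\big)$ for $n\geq 1$ (so $g\in\mathbb{F}$), and put $\mathcal{B}_m^k(f,\beta)=g\big(\mathcal{B}(m-1,f\circ g)+1\big)$. Finally, $\mathcal{B}(m,f)=\mathcal{B}_m^0(f)$ (for $k=0$ the tuple $\beta$ is empty). *)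

theory Defs
  imports Main
begin

text \<open>Functions on the positive integers are represented by functions on all of
  \<^typ>\<open>nat\<close>; the value at \<open>0\<close> is unconstrained and never used.\<close>

definition FF :: "(nat \<Rightarrow> nat) set" where
  "FF = {f. (\<forall>n\<ge>1. f n \<ge> 1) \<and> (\<forall>i j. 1 \<le> i \<longrightarrow> i \<le> j \<longrightarrow> f i \<le> f j)}"

definition vecs :: "nat \<Rightarrow> nat list set" where
  "vecs m = {\<alpha>. length \<alpha> = m}"

definition vec_par :: "nat \<Rightarrow> nat list \<Rightarrow> nat list \<Rightarrow> bool" where
  "vec_par m \<alpha> \<beta> \<longleftrightarrow> (\<exists>\<gamma>\<in>vecs m. map2 (+) \<alpha> \<gamma> = \<beta>)"

text \<open>The sequences are indexed by \<open>1, \<dots>, t\<close>, and incomparability is required in one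
  direction only.\<close>

definition antichain_seq :: "nat \<Rightarrow> nat \<Rightarrow> (nat \<Rightarrow> nat list) \<Rightarrow> bool" where
  "antichain_seq m t \<alpha> \<longleftrightarrow>
     (\<forall>i\<in>{1..t}. \<alpha> i \<in> vecs m) \<and>
     (\<forall>i\<in>{1..t}. \<forall>j\<in>{1..t}. i < j \<longrightarrow> \<not> vec_par m (\<alpha> i) (\<alpha> j))"

definition bounded_seq :: "(nat \<Rightarrow> nat) \<Rightarrow> nat \<Rightarrow> (nat \<Rightarrow> nat list) \<Rightarrow> bool" where
  "bounded_seq f t \<alpha> \<longleftrightarrow> (\<forall>i\<in>{1..t}. sum_list (\<alpha> i) \<le> f i)"

definition shift :: "nat \<Rightarrow> (nat \<Rightarrow> nat) \<Rightarrow> nat \<Rightarrow> nat" where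
  "shift s f = (\<lambda>n. f (s + n))"

text \<open>Here \<open>calB m f\<close> is \<open>\<B>(m, f)\<close>, \<open>calBk m k f \<beta>\<close> is \<open>\<B>\<^sub>m\<^sup>k(f, \<beta>)\<close> with \<open>\<beta>\<close> a list of length
  \<open>k\<close>, and \<open>calg m k f \<beta>\<close> is the auxiliary function \<open>g\<close> from the recursive clause for
  \<open>\<B>\<^sub>m\<^sup>k(f, \<beta>)\<close>. Only \<open>m \<ge> 1\<close> matters for \<open>calB\<close>, only \<open>m \<ge> 2\<close> and \<open>k \<le> m\<close> for \<open>calBk\<close>, and only
  \<open>m \<ge> 2\<close>, \<open>k < m\<close> and positive arguments for \<open>calg\<close>; other values are junk.\<close>

function calB :: "nat \<Rightarrow> (nat \<Rightarrow> nat) \<Rightarrow> nat"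
  and calBk :: "nat \<Rightarrow> nat \<Rightarrow> (nat \<Rightarrow> nat) \<Rightarrow> nat list \<Rightarrow> nat"
  and calg :: "nat \<Rightarrow> nat \<Rightarrow> (nat \<Rightarrow> nat) \<Rightarrow> nat list \<Rightarrow> nat \<Rightarrow> nat"
where
  "calB m f = (if m \<le> 1 then f 1 + 1 else calBk m 0 f [])"
| "calBk m k f \<beta> =
     (if k < m then calg m k f \<beta> (calB (m - 1) (\<lambda>n. f (calg m k f \<beta> n)) + 1)
      else (\<Prod>b\<leftarrow>\<beta>. b + 1))"
| "calg m k f \<beta> n =
     (if n \<le> 1 \<or> m \<le> k then 1
      else 1 + calg m k f \<beta> (n - 1) +
           calBk m (k + 1) (shift (calg m k f \<beta> (n - 1)) f)
             (\<beta> @ [f (calg m k f \<beta> (n - 1))]))"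
  by pat_completeness auto

termination
  by (relation "inv_image (less_than <*lex*> less_than <*lex*> less_than <*lex*> less_than)
       (\<lambda>x. case x of Inl (m, f) \<Rightarrow> (m, m, 2, 0)
         | Inr (Inl (m, k, f, \<beta>)) \<Rightarrow> (m, m - k, 1, 0)
         | Inr (Inr (m, k, f, \<beta>, n)) \<Rightarrow> (m, m - k, 0, n))") auto

declare calB.simps [simp del] calBk.simps [simp del] calg.simps [simp del]

lemma calB_1: "calB 1 f = f 1 + 1"
  by (simp add: calB.simps)

lemma calB_ge_2: "m \<ge> 2 \<Longrightarrow> calB m f = calBk m 0 f []"
  by (simp add: calB.simps)

lemma calBk_top: "calBk m m f \<beta> = (\<Prod>b\<leftarrow>\<beta>. b + 1)"
  by (simp add: calBk.simps)

lemma calBk_less: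
  "k < m \<Longrightarrow> calBk m k f \<beta> = calg m k f \<beta> (calB (m - 1) (f \<circ> calg m k f \<beta>) + 1)"
  by (simp add: calBk.simps[of m k] comp_def)

lemma calg_1: "calg m k f \<beta> 1 = 1"
  by (simp add: calg.simps)

lemma calg_Suc:
  "\<lbrakk>k < m; n \<ge> 1\<rbrakk> \<Longrightarrow>
     calg m k f \<beta> (n + 1) =
       1 + calg m k f \<beta> n +
       calBk m (k + 1) (shift (calg m k f \<beta> n) f) (\<beta> @ [f (calg m k f \<beta> n)])"
  by (subst calg.simps) simp

lemma calg_in_FF: "k < m \<Longrightarrow> calg m k f \<beta> \<in> FF"
proof -
  assume km: "k < m"
  have pos: "calg m k f \<beta> n \<ge> 1" for n
    by (subst calg.simps) simp
  have "calg m k f \<beta> n \<le> calg m k f \<beta> (Suc n)" for n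
  proof (cases "n \<ge> 1")
    case True
    then show ?thesis using calg_Suc[OF km True, of f \<beta>] by simp
  next
    case False
    then show ?thesis using km by (simp add: calg.simps)
  qed
  then have "calg m k f \<beta> i \<le> calg m k f \<beta> j" if "i \<le> j" for i j
    using that by (rule lift_Suc_mono_le)
  with pos show ?thesis
    by (simp add: FF_def)
qed

end

theory Submission imports Defs
begin

text \<open>\<open>\<B>\<^sub>m\<^sup>k(f, \<beta>)\<close> bounds the length of an \<open>f\<close>-bounded antichain in \<open>\<nat>\<^sup>m\<close> whose first \<open>k\<close> coordinates
  stay below \<open>\<beta>\<close>. For \<open>k = m\<close> one counts a box. For \<open>k < m\<close>, the elements with indices in
  \<open>(g(n), g(n+1)]\<close> are too many for coordinate \<open>k + 1\<close> to stay below \<open>f(g(n))\<close> on all of them, so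
  one can pick a subsequence \<open>j\<^sub>n \<le> g(n)\<close> along which this coordinate strictly increases. Deleting
  the coordinate leaves an \<open>f \<circ> g\<close>-bounded antichain in \<open>\<nat>\<^bsup>m - 1\<^esup>\<close>, which has at most
  \<open>\<B>(m - 1, f \<circ> g)\<close> elements.\<close>

section \<open>Closure properties of the non-decreasing functions\<close>

lemma FF_D:
  assumes "f \<in> FF"
  shows FF_ge_1: "n \<ge> 1 \<Longrightarrow> f n \<ge> 1" and FF_mono: "1 \<le> i \<Longrightarrow> i \<le> j \<Longrightarrow> f i \<le> f j"
  using assms by (auto simp: FF_def)

lemma shift_in_FF: "f \<in> FF \<Longrightarrow> shift s f \<in> FF"
  by (auto simp: FF_def shift_def)

lemma comp_in_FF: "f \<in> FF \<Longrightarrow> g \<in> FF \<Longrightarrow> f \<circ> g \<in> FF"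
  by (auto simp: FF_def)

section \<open>Antichains confined to a box\<close>

lemma vec_par_iff_list_all2:
  assumes "length \<alpha> = m" "length \<beta> = m"
  shows "vec_par m \<alpha> \<beta> \<longleftrightarrow> list_all2 (\<le>) \<alpha> \<beta>"
proof
  assume "vec_par m \<alpha> \<beta>"
  then show "list_all2 (\<le>) \<alpha> \<beta>"
    using assms by (auto simp: vec_par_def vecs_def list_all2_conv_all_nth)
next
  assume le: "list_all2 (\<le>) \<alpha> \<beta>"
  \<comment> \<open>Truncated subtraction is exact here, because \<alpha> lies below \<beta> in
    every coordinate.\<close>
  have "map2 (+) \<alpha> (map2 (-) \<beta> \<alpha>) = \<beta>"
    using assms le by (intro nth_equalityI) (auto simp: list_all2_conv_all_nth)
  moreover have "map2 (-) \<beta> \<alpha> \<in> vecs m"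
    using assms by (simp add: vecs_def)
  ultimately show "vec_par m \<alpha> \<beta>"
    by (auto simp: vec_par_def)
qed

lemma finite_card_box:
  "finite {\<alpha>. list_all2 (\<le>) \<alpha> \<beta>} \<and> card {\<alpha>. list_all2 (\<le>) \<alpha> \<beta>} = (\<Prod>b\<leftarrow>\<beta>. b + 1)"
  for \<beta> :: "nat list"
proof (induction \<beta>)
  case (Cons b \<beta>)
  have eq: "{\<alpha>. list_all2 (\<le>) \<alpha> (b # \<beta>)} =
      (\<lambda>(x, xs). x # xs) ` ({..b} \<times> {\<alpha>. list_all2 (\<le>) \<alpha> \<beta>})"
    by (auto simp: list_all2_Cons2)
  have "inj_on (\<lambda>(x, xs). x # xs) ({..b} \<times> {\<alpha>. list_all2 (\<le>) \<alpha> \<beta>})"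
    by (auto simp: inj_on_def)
  with Cons show ?case
    unfolding eq by (simp add: card_image card_cartesian_product)
qed simp

text \<open>A repeated vector would be comparable with itself.\<close>

lemma antichain_seq_inj_on: "antichain_seq m t \<alpha> \<Longrightarrow> inj_on \<alpha> {1..t}"
proof (rule linorder_inj_onI)
  fix i j
  assume "antichain_seq m t \<alpha>" "i < j" "i \<in> {1..t}" "j \<in> {1..t}"
  then have "length (\<alpha> i) = m" "\<not> vec_par m (\<alpha> i) (\<alpha> j)"
    by (auto simp: antichain_seq_def vecs_def)
  then show "\<alpha> i \<noteq> \<alpha> j"
    by (auto simp: vec_par_iff_list_all2 list_all2_conv_all_nth)
qed auto

lemma antichain_seq_in_box:
  assumes "antichain_seq m t \<alpha>" and "\<And>i. i \<in> {1..t} \<Longrightarrow> list_all2 (\<le>) (\<alpha> i) \<beta>"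
  shows "t \<le> (\<Prod>b\<leftarrow>\<beta>. b + 1)"
proof -
  have "card (\<alpha> ` {1..t}) \<le> card {\<alpha>. list_all2 (\<le>) \<alpha> \<beta>}"
    using finite_card_box[of \<beta>] assms(2) by (intro card_mono) auto
  then show ?thesis
    using finite_card_box[of \<beta>] antichain_seq_inj_on[OF assms(1)] by (simp add: card_image)
qed

text \<open>In dimension one every later entry is smaller than the first, so the whole sequence lies
  in the box \<open>[f 1]\<close>.\<close>

lemma antichain_seq_one_bound:
  assumes "antichain_seq 1 t \<alpha>" "bounded_seq f t \<alpha>"
  shows "t \<le> f 1 + 1"
proof -
  have "list_all2 (\<le>) (\<alpha> i) [f 1]" if i: "i \<in> {1..t}" for i
  proof -
    have "\<exists>x. \<alpha> i' = [x]" if "i' \<in> {1..t}" for i'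
      using assms(1) that by (auto simp: antichain_seq_def vecs_def length_Suc_conv)
    from this[of i] this[of 1] obtain x y where xy: "\<alpha> i = [x]" "\<alpha> 1 = [y]"
      using i by auto
    have "y \<le> f 1"
      using assms(2) i xy by (auto simp: bounded_seq_def dest: bspec[of _ _ 1])
    moreover have "x \<le> y"
    proof (cases "i = 1")
      case False
      with i have "\<not> vec_par 1 (\<alpha> 1) (\<alpha> i)"
        using assms(1) by (auto simp: antichain_seq_def)
      with xy show ?thesis by (simp add: vec_par_iff_list_all2)
    qed (use xy in simp)
    ultimately show ?thesis using xy by simp
  qed
  from antichain_seq_in_box[OF assms(1) this] show ?thesis by simp
qed

section \<open>Blocks of an antichain and deletion of a coordinate\<close>

lemma antichain_seq_shift:
  "antichain_seq m t \<alpha> \<Longrightarrow> s + u \<le> t \<Longrightarrow> antichain_seq m u (\<lambda>i. \<alpha> (s + i))"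
  by (auto simp: antichain_seq_def)

lemma bounded_seq_shift:
  "bounded_seq f t \<alpha> \<Longrightarrow> s + u \<le> t \<Longrightarrow> bounded_seq (shift s f) u (\<lambda>i. \<alpha> (s + i))"
  by (auto simp: bounded_seq_def shift_def)

definition del_nth :: "nat \<Rightarrow> 'a list \<Rightarrow> 'a list" where
  "del_nth k xs = take k xs @ drop (Suc k) xs"

lemma length_del_nth: "k < length xs \<Longrightarrow> length (del_nth k xs) = length xs - 1"
  by (simp add: del_nth_def)

lemma sum_list_del_nth_le: "k < length xs \<Longrightarrow> sum_list (del_nth k xs) \<le> sum_list xs"
  for xs :: "nat list"
proof -
  assume "k < length xs"
  then have "sum_list xs = sum_list (take k xs @ xs ! k # drop (Suc k) xs)"
    by (metis id_take_nth_drop)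
  then show ?thesis by (simp add: del_nth_def)
qed

lemma list_all2_del_nthD:
  assumes "list_all2 P (del_nth k xs) (del_nth k ys)" "P (xs ! k) (ys ! k)"
    and "k < length xs" "length xs = length ys"
  shows "list_all2 P xs ys"
proof -
  have "list_all2 P (take k xs) (take k ys)" "list_all2 P (drop (Suc k) xs) (drop (Suc k) ys)"
    using assms by (simp_all add: del_nth_def list_all2_append)
  then have "list_all2 P (take k xs @ xs ! k # drop (Suc k) xs) (take k ys @ ys ! k # drop (Suc k) ys)"
    using assms(2) by (intro list_all2_appendI) simp_all
  then show ?thesis
    using assms(3,4) by (simp add: Cons_nth_drop_Suc)
qed

text \<open>If two shortened vectors were comparable, the weak growth of coordinate \<open>k\<close>
  along the subsequence would make the full vectors comparable too.\<close>

lemma antichain_seq_del_nth: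
  assumes anti: "antichain_seq m t \<alpha>" and "k < m"
    and range: "\<And>n. n \<in> {1..u} \<Longrightarrow> j n \<in> {1..t}"
    and less: "\<And>n n'. n \<in> {1..u} \<Longrightarrow> n' \<in> {1..u} \<Longrightarrow> n < n' \<Longrightarrow> j n < j n'"
    and coord: "\<And>n n'. n \<in> {1..u} \<Longrightarrow> n' \<in> {1..u} \<Longrightarrow> n < n' \<Longrightarrow> \<alpha> (j n) ! k \<le> \<alpha> (j n') ! k"
  shows "antichain_seq (m - 1) u (\<lambda>n. del_nth k (\<alpha> (j n)))"
proof -
  have len: "length (\<alpha> (j n)) = m" if "n \<in> {1..u}" for n
    using anti range[OF that] by (auto simp: antichain_seq_def vecs_def)
  have "\<not> vec_par (m - 1) (del_nth k (\<alpha> (j n))) (del_nth k (\<alpha> (j n')))"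
    if n: "n \<in> {1..u}" "n' \<in> {1..u}" "n < n'" for n n'
  proof
    note lens = len[OF n(1)] len[OF n(2)]
    assume "vec_par (m - 1) (del_nth k (\<alpha> (j n))) (del_nth k (\<alpha> (j n')))"
    then have "list_all2 (\<le>) (del_nth k (\<alpha> (j n))) (del_nth k (\<alpha> (j n')))"
      using lens \<open>k < m\<close> by (simp add: vec_par_iff_list_all2 length_del_nth)
    then have "list_all2 (\<le>) (\<alpha> (j n)) (\<alpha> (j n'))"
      using coord[OF n] lens \<open>k < m\<close> by (auto elim: list_all2_del_nthD)
    then have "vec_par m (\<alpha> (j n)) (\<alpha> (j n'))"
      using lens by (simp add: vec_par_iff_list_all2)
    with anti show False
      using range[OF n(1)] range[OF n(2)] less[OF n] unfolding antichain_seq_def by blast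
  qed
  then show ?thesis
    using len \<open>k < m\<close> by (auto simp: antichain_seq_def vecs_def length_del_nth)
qed

section \<open>Length bound for partially confined antichains\<close>

lemma calBk_bounding:
  assumes bounding: "\<And>f t \<alpha>. f \<in> FF \<Longrightarrow> antichain_seq (m - 1) t \<alpha> \<Longrightarrow> bounded_seq f t \<alpha> \<Longrightarrow>
      t \<le> calB (m - 1) f"
    and "k \<le> m" "f \<in> FF" "antichain_seq m t \<alpha>" "bounded_seq f t \<alpha>"
    and "\<And>i. i \<in> {1..t} \<Longrightarrow> list_all2 (\<le>) (take k (\<alpha> i)) \<beta>"
  shows "t \<le> calBk m k f \<beta>"
  using assms(2-)
\<comment> \<open>The induction runs from \<open>k = m\<close> downwards. It generalises over
  everything else because the hypothesis is applied to a block of \<alpha>, with \<open>f\<close>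
  shifted and \<beta> extended by one entry.\<close>
proof (induction k arbitrary: f t \<alpha> \<beta> rule: inc_induct)
  case base
  have "list_all2 (\<le>) (\<alpha> i) \<beta>" if "i \<in> {1..t}" for i
    using base(4)[OF that] base(2) that by (auto simp: antichain_seq_def vecs_def)
  with base(2) show ?case
    unfolding calBk_top by (rule antichain_seq_in_box)
next
  case (step k)
  note f = \<open>f \<in> FF\<close> and anti = \<open>antichain_seq m t \<alpha>\<close> and bnd = \<open>bounded_seq f t \<alpha>\<close>
  define g where "g = calg m k f \<beta>"
  define N where "N = calB (m - 1) (f \<circ> g)"
  have g: "g \<in> FF" and g1: "g 1 = 1"
    using calg_in_FF[OF \<open>k < m\<close>] calg_1 by (simp_all add: g_def)
  have g_Suc: "g (n + 1) = 1 + g n + calBk m (Suc k) (shift (g n) f) (\<beta> @ [f (g n)])"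
    if "n \<ge> 1" for n
    using calg_Suc[OF \<open>k < m\<close> that] by (simp add: g_def)
  have len: "length (\<alpha> i) = m" if "i \<in> {1..t}" for i
    using anti that by (auto simp: antichain_seq_def vecs_def)
  have "t \<le> g (N + 1)"
  proof (rule ccontr)
    assume "\<not> t \<le> g (N + 1)"
    then have g_le: "g n \<le> t" if "n \<in> {1..N+1}" for n
      using FF_mono[OF g, of n "N + 1"] that by simp
    \<comment> \<open>Otherwise the block after index \<open>g n\<close> would have its first
      \<open>k + 1\<close> coordinates below \<open>\<beta> @ [f (g n)]\<close>. The summand
      \<open>1\<close> in the recursion for \<open>g\<close> makes the block one element too long
      for that.\<close>
    have "\<exists>j. g n < j \<and> j \<le> g (n + 1) \<and> f (g n) < \<alpha> j ! k" if n: "n \<in> {1..N}" for n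
    proof (rule ccontr)
      assume contr: "\<nexists>j. g n < j \<and> j \<le> g (n + 1) \<and> f (g n) < \<alpha> j ! k"
      define u where "u = g (n + 1) - g n"
      have u: "g n + u = g (n + 1)" "u = Suc (calBk m (Suc k) (shift (g n) f) (\<beta> @ [f (g n)]))"
        using g_Suc[of n] n by (simp_all add: u_def)
      have ut: "g n + u \<le> t"
        using g_le[of "n + 1"] n u(1) by simp
      have "u \<le> calBk m (Suc k) (shift (g n) f) (\<beta> @ [f (g n)])"
      proof (rule step.IH)
        show "list_all2 (\<le>) (take (Suc k) (\<alpha> (g n + i))) (\<beta> @ [f (g n)])" if i: "i \<in> {1..u}" for i
        proof -
          have "g n + i \<in> {1..t}" using i ut by simp
          moreover have "\<alpha> (g n + i) ! k \<le> f (g n)"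
            using contr i u(1) by (metis add_left_mono atLeastAtMost_iff less_add_same_cancel1
              linorder_not_le less_eq_Suc_le One_nat_def)
          ultimately show ?thesis
            using step.prems(4) len \<open>k < m\<close>
            by (simp add: take_Suc_conv_app_nth list_all2_appendI)
        qed
      qed (rule shift_in_FF[OF f] antichain_seq_shift[OF anti ut] bounded_seq_shift[OF bnd ut])+
      with u(2) show False by simp
    qed
    then obtain h where h: "\<And>n. n \<in> {1..N} \<Longrightarrow> g n < h n \<and> h n \<le> g (n + 1) \<and> f (g n) < \<alpha> (h n) ! k"
      by metis
    \<comment> \<open>The start \<open>j 1 = 1\<close> agrees with \<open>g 1 = 1\<close>; each
      later index comes from the preceding block, so that \<open>j n \<le> g n\<close>. The
      \<open>N\<close> blocks thus give \<open>N + 1\<close> indices.\<close>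
    define j where "j n = (if n \<le> 1 then 1 else h (n - 1))" for n
    have j_le: "1 \<le> j n \<and> j n \<le> g n" if "n \<in> {1..N+1}" for n
    proof (cases "n = 1")
      case False
      with that have "n - 1 \<in> {1..N}" by auto
      with h[OF this] that show ?thesis by (simp add: j_def)
    qed (use g1 in \<open>simp add: j_def\<close>)
    have j_range: "j n \<in> {1..t}" if "n \<in> {1..N+1}" for n
      using j_le[OF that] g_le[OF that] by simp
    have sum_le: "sum_list (\<alpha> (j n)) \<le> f (g n)" if "n \<in> {1..N+1}" for n
    proof -
      have "sum_list (\<alpha> (j n)) \<le> f (j n)"
        using bnd j_range[OF that] by (simp add: bounded_seq_def)
      also have "\<dots> \<le> f (g n)"
        using FF_mono[OF f] j_le[OF that] by simp
      finally show ?thesis .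
    qed
    \<comment> \<open>The threshold \<open>f (g n)\<close> was chosen for this: it bounds the whole
      coordinate sum of \<open>\<alpha> (j n)\<close>, hence its coordinate \<open>k\<close>, while
      coordinate \<open>k\<close> of \<open>\<alpha> (j n')\<close> exceeds
      \<open>f (g (n' - 1))\<close>.\<close>
    have incr: "j n < j n' \<and> \<alpha> (j n) ! k < \<alpha> (j n') ! k"
      if n: "n \<in> {1..N+1}" "n' \<in> {1..N+1}" "n < n'" for n n'
    proof -
      have gn: "g n \<le> g (n' - 1)" "1 \<le> g n"
        using n FF_mono[OF g, of n "n' - 1"] FF_ge_1[OF g, of n] by auto
      have j': "g (n' - 1) < j n'" "f (g (n' - 1)) < \<alpha> (j n') ! k"
      proof -
        have "n' - 1 \<in> {1..N}" using n by auto
        with h[OF this] n show "g (n' - 1) < j n'" "f (g (n' - 1)) < \<alpha> (j n') ! k"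
          by (simp_all add: j_def)
      qed
      have "\<alpha> (j n) ! k \<le> sum_list (\<alpha> (j n))"
        using len[OF j_range[OF n(1)]] \<open>k < m\<close> by (simp add: member_le_sum_list)
      also have "\<dots> \<le> f (g n)" by (rule sum_le[OF n(1)])
      also have "\<dots> \<le> f (g (n' - 1))" using FF_mono[OF f gn(2,1)] .
      finally show ?thesis using j' gn j_le[OF n(1)] by linarith
    qed
    have "antichain_seq (m - 1) (N + 1) (\<lambda>n. del_nth k (\<alpha> (j n)))"
      using j_range incr by (intro antichain_seq_del_nth[OF anti \<open>k < m\<close>]) (simp_all add: less_imp_le)
    moreover have "bounded_seq (f \<circ> g) (N + 1) (\<lambda>n. del_nth k (\<alpha> (j n)))"
      unfolding bounded_seq_def
      using sum_le order.trans[OF sum_list_del_nth_le] len j_range \<open>k < m\<close> by auto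
    ultimately have "N + 1 \<le> N"
      unfolding N_def by (intro bounding comp_in_FF f g)
    then show False by simp
  qed
  then show ?case
    unfolding calBk_less[OF \<open>k < m\<close>] N_def g_def .
qed

section \<open>Monotonicity in the function and in the box\<close>

lemma prod_list_Suc_mono:
  "list_all2 (\<le>) \<beta> \<beta>' \<Longrightarrow> (\<Prod>b\<leftarrow>\<beta>. b + 1) \<le> (\<Prod>b\<leftarrow>\<beta>'. b + 1)" for \<beta> :: "nat list"
  by (induction rule: list_all2_induct) (auto intro!: add_mono mult_mono)

text \<open>Enlarging \<open>f\<close> and \<beta> enlarges both the auxiliary function
  \<open>g\<close> and the point at which it is evaluated.\<close>

lemma calBk_mono:
  assumes mono: "\<And>f f'. f \<in> FF \<Longrightarrow> f' \<in> FF \<Longrightarrow> (\<And>n. n \<ge> 1 \<Longrightarrow> f n \<le> f' n) \<Longrightarrow>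
      calB (m - 1) f \<le> calB (m - 1) f'"
    and "k \<le> m" "f \<in> FF" "f' \<in> FF" "\<And>n. n \<ge> 1 \<Longrightarrow> f n \<le> f' n" "list_all2 (\<le>) \<beta> \<beta>'"
  shows "calBk m k f \<beta> \<le> calBk m k f' \<beta>'"
  using assms(2-)
proof (induction k arbitrary: f f' \<beta> \<beta>' rule: inc_induct)
  case base
  then show ?case unfolding calBk_top by (intro prod_list_Suc_mono)
next
  case (step k)
  note IH = step.IH and f = \<open>f \<in> FF\<close> and f' = \<open>f' \<in> FF\<close>
  define g where "g = calg m k f \<beta>"
  define g' where "g' = calg m k f' \<beta>'"
  have g: "g \<in> FF" and g': "g' \<in> FF"
    using calg_in_FF[OF \<open>k < m\<close>] by (simp_all add: g_def g'_def)
  \<comment> \<open>The arguments may differ because the two sides are evaluated at, and shifted by,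
    \<open>g n\<close> and the possibly larger \<open>g' n\<close>.\<close>
  have f_le: "f i \<le> f' i'" if "1 \<le> i" "i \<le> i'" for i i'
    using step.prems(3)[OF that(1)] FF_mono[OF f' that] by simp
  have g_le: "g n \<le> g' n" if "n \<ge> 1" for n
    using that
  proof (induction n rule: dec_induct)
    case base
    then show ?case
      unfolding g_def g'_def calg_1 by simp
  next
    case (step n)
    have "g n \<ge> 1" using FF_ge_1[OF g step(1)] .
    then have "calBk m (Suc k) (shift (g n) f) (\<beta> @ [f (g n)])
        \<le> calBk m (Suc k) (shift (g' n) f') (\<beta>' @ [f' (g' n)])"
      using step \<open>list_all2 (\<le>) \<beta> \<beta>'\<close>
      by (intro IH shift_in_FF f f') (auto intro!: f_le list_all2_appendI simp: shift_def)
    then show ?case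
      using calg_Suc[OF \<open>k < m\<close> step(1), of f \<beta>] calg_Suc[OF \<open>k < m\<close> step(1), of f' \<beta>'] step(3)
      by (simp add: g_def g'_def)
  qed
  have "calB (m - 1) (f \<circ> g) \<le> calB (m - 1) (f' \<circ> g')"
    using g_le FF_ge_1[OF g] by (intro mono comp_in_FF f f' g g') (auto intro!: f_le)
  \<comment> \<open>First the argument grows while \<open>g\<close> is kept, then \<open>g\<close>
    is replaced by \<open>g'\<close>.\<close>
  then have "g (calB (m - 1) (f \<circ> g) + 1) \<le> g (calB (m - 1) (f' \<circ> g') + 1)"
    by (intro FF_mono[OF g]) simp_all
  also have "\<dots> \<le> g' (calB (m - 1) (f' \<circ> g') + 1)"
    by (intro g_le) simp
  finally show ?case
    unfolding calBk_less[OF \<open>k < m\<close>] g_def g'_def .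
qed

section \<open>Induction on the dimension\<close>

lemma calB_bounding:
  assumes "m \<ge> 1" "f \<in> FF" "antichain_seq m t \<alpha>" "bounded_seq f t \<alpha>"
  shows "t \<le> calB m f"
  using assms
proof (induction m arbitrary: f t \<alpha> rule: dec_induct)
  case base
  then show ?case unfolding calB_1 by (intro antichain_seq_one_bound)
next
  case (step m)
  then show ?case
    \<comment> \<open>For \<open>k = 0\<close> the box condition only compares empty lists.\<close>
    using calBk_bounding[of "Suc m" 0 f t \<alpha> "[]"] calB_ge_2[of "Suc m"] by simp
qed

lemma calB_mono:
  assumes "m \<ge> 1" "f \<in> FF" "f' \<in> FF" "\<And>n. n \<ge> 1 \<Longrightarrow> f n \<le> f' n"
  shows "calB m f \<le> calB m f'"
  using assms
proof (induction m arbitrary: f f' rule: dec_induct)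
  case base
  then show ?case unfolding calB_1 by simp
next
  case (step m)
  then show ?case
    using calBk_mono[of "Suc m" 0 f f' "[]" "[]"] calB_ge_2[of "Suc m"] by simp
qed

theorem theorem3p5:
  fixes m :: nat
  assumes "m \<ge> 1"
  shows "(\<forall>f\<in>FF. \<forall>t. \<forall>\<alpha>. antichain_seq m t \<alpha> \<and> bounded_seq f t \<alpha> \<longrightarrow> t \<le> calB m f) \<and>
         (\<forall>f\<in>FF. \<forall>f'\<in>FF. (\<forall>n\<ge>1. f n \<le> f' n) \<longrightarrow> calB m f \<le> calB m f')"
  using calB_bounding[OF assms] calB_mono[OF assms] by blast

end
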